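(* Let $G$ be a connected (possibly weighted) undirected graph on $n$ vertices with adjacency matrix $A\in\mathbf{R}^{n\times n}$ and algebraic connectivity $\lambda_2$. Let $z\in\{\pm1\}^n$, let $\Delta\in\mathbf{R}^{n\times n}$ be a symmetric matrix with zero diagonal, and let $$C = \mathrm{diag}(z)\, A\, \mathrm{diag}(z) + \Delta, \qquad\text{that is,}\qquad C_{ij} = A_{ij}z_iz_j + \Delta_{ij}.$$ Set $$\rho^\Delta = \max_{1\le i\le n} \rho_i^\Delta, \qquad \rho^\Delta_i = -z_i \sum_{\substack{j=1\\ j\neq i}}^n \Delta_{ij}z_j.$$ Let $r\geq 4$ be an integer, and suppose $$\rho^\Delta + \frac{r+11}{r-3}\lVert\Delta\rVert_{\mathrm{op}} \leq \frac{r-3}{r-1}\lambda_2.$$ Then every second-order critical point $Y\in\mathbf{R}^{n\times r}$ of the problem $$\max_{Y \in \mathbf{R}^{n\times r}}~\langle C, YY^\top\rangle \quad \text{s.t. } \mathrm{ddiag}(YY^\top) = I_n$$ satisfies $Y = zu^\top$ for some unit-norm $u\in\mathbf{R}^r$. The same result holds if $r=3$ and $\Delta = 0$.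
   Context: The adjacency matrix $A$ is symmetric with nonnegative entries and zero diagonal. The graph Laplacian is $L = \mathrm{diag}(A\mathbf{1}) - A$, where $\mathbf{1}$ is the all-ones vector; its eigenvalues are $0=\lambda_1\le\lambda_2\le\dots\le\lambda_n$, and $\lambda_2$ is the algebraic connectivity of $G$. $\lVert\cdot\rVert_{\mathrm{op}}$ is the $\ell_2$ operator norm. $\mathrm{diag}(v)$ is the diagonal matrix with diagonal $v$. $\langle A,B\rangle = \mathrm{trace}(A^\top B)$ is the Frobenius inner product; $\mathrm{ddiag}\colon \mathbf{R}^{n\times n}\to\mathbf{R}^{n\times n}$ keeps the diagonal of a matrix and sets the off-diagonal entries to zero. The constraint $\mathrm{ddiag}(YY^\top)=I_n$ says that every row of $Y$ is a unit vector in $\mathbf{R}^r$, so the feasible set is a Riemannian manifold (a product of $n$ unit spheres embedded in $\mathbf{R}^r$). A second-order critical point is a feasible $Y$ at which the Riemannian gradient of the objective is zero and the Riemannian Hessian is negative semidefinite. Explicitly, for symmetric $C$, put $S(Y) = \mathrm{ddiag}(CYY^\top) - C$; a feasible $Y$ is second-order critical if and only if (i) $S(Y)Y = 0$, and (ii) $\langle S(Y), \dot Y \dot Y^\top\rangle \ge 0$ for every $\dot Y\in\mathbf{R}^{n\times r}$ such that $\mathrm{ddiag}(Y\dot Y^\top)=0$. *)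

theory Defs
  imports "HOL-Analysis.Analysis" "HOL-Computational_Algebra.Computational_Algebra"
begin

section \<open>Matrices\<close>

definition diag :: "real^'n \<Rightarrow> real^'n^'n" where
  "diag v = (\<chi> i j. if i = j then v $ i else 0)"

definition ddiag :: "real^'n^'n \<Rightarrow> real^'n^'n" where
  "ddiag M = (\<chi> i j. if i = j then M $ i $ j else 0)"

definition frob :: "real^'m^'n \<Rightarrow> real^'m^'n \<Rightarrow> real" where
  "frob A B = trace (transpose A ** B)"

definition op_norm :: "real^'n^'n \<Rightarrow> real" where
  "op_norm M = onorm (\<lambda>x. M *v x)"

definition charpoly :: "real^'n^'n \<Rightarrow> real poly" where
  "charpoly A = det (\<chi> i j. (if i = j then [:0, 1:] else 0) - [:A $ i $ j:])"

text \<open>Real eigenvalues in ascending order, repeated according to multiplicity. For a symmetric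
  matrix the list has \<open>CARD('n)\<close> entries.\<close>

definition eigenvalues :: "real^'n^'n \<Rightarrow> real list" where
  "eigenvalues A = sorted_list_of_multiset (proots (charpoly A))"


section \<open>Weighted graphs\<close>

text \<open>A weighted graph on the vertex type is given by its adjacency matrix; \<open>{i, j}\<close> is an edge
  iff the entry at \<open>(i, j)\<close> is nonzero.\<close>

definition adjacency_matrix :: "real^'n^'n \<Rightarrow> bool" where
  "adjacency_matrix A \<longleftrightarrow>
     transpose A = A \<and> (\<forall>i j. 0 \<le> A $ i $ j) \<and> (\<forall>i. A $ i $ i = 0)"

definition connected_graph :: "real^'n^'n \<Rightarrow> bool" where
  "connected_graph A \<longleftrightarrow> (\<forall>i j. (i, j) \<in> {(k, l). A $ k $ l \<noteq> 0}\<^sup>*)"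

definition laplacian :: "real^'n^'n \<Rightarrow> real^'n^'n" where
  "laplacian A = diag (A *v 1) - A"

text \<open>List positions count from \<open>0\<close>. On a single vertex there is no second eigenvalue and the
  value is unspecified.\<close>

definition algebraic_connectivity :: "real^'n^'n \<Rightarrow> real" where
  "algebraic_connectivity A = eigenvalues (laplacian A) ! 1"


section \<open>Optimization over a product of spheres\<close>

definition feasible :: "real^'r^'n \<Rightarrow> bool" where
  "feasible Y \<longleftrightarrow> ddiag (Y ** transpose Y) = mat 1"

definition objective :: "real^'n^'n \<Rightarrow> real^'r^'n \<Rightarrow> real" where
  "objective C Y = frob C (Y ** transpose Y)"

definition tangent_space :: "real^'r^'n \<Rightarrow> (real^'r^'n) set" where
  "tangent_space Y = {V. ddiag (Y ** transpose V) = 0}"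

text \<open>For feasible \<open>Y\<close> this is the orthogonal projection onto the tangent space, see
  \<open>proj_tangent_orthogonal\<close> below. The formula is used for all \<open>Y\<close>, so that it is smooth
  in \<open>Y\<close> on the whole matrix space.\<close>

definition proj_tangent :: "real^'r^'n \<Rightarrow> real^'r^'n \<Rightarrow> real^'r^'n" where
  "proj_tangent Y Z = Z - ddiag (Z ** transpose Y) ** Y"

text \<open>The inner product of the type \<open>real^'r^'n\<close> is the Frobenius inner product
  (\<open>frob_eq_inner\<close>), hence \<open>GDERIV\<close> is the gradient with respect to it.\<close>

definition euclidean_gradient :: "(real^'r^'n \<Rightarrow> real) \<Rightarrow> real^'r^'n \<Rightarrow> real^'r^'n" where
  "euclidean_gradient f Y = (THE g. GDERIV f Y :> g)"

definition riemannian_gradient :: "(real^'r^'n \<Rightarrow> real) \<Rightarrow> real^'r^'n \<Rightarrow> real^'r^'n" where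
  "riemannian_gradient f Y = proj_tangent Y (euclidean_gradient f Y)"

text \<open>On an embedded Riemannian submanifold, the Hessian along a tangent vector is the projection
  of the directional derivative of any smooth extension of the gradient field; here the extension
  is the one provided by the formula for \<open>proj_tangent\<close>.\<close>

definition riemannian_hessian ::
    "(real^'r^'n \<Rightarrow> real) \<Rightarrow> real^'r^'n \<Rightarrow> real^'r^'n \<Rightarrow> real^'r^'n" where
  "riemannian_hessian f Y V = proj_tangent Y (frechet_derivative (riemannian_gradient f) (at Y) V)"

definition second_order_critical :: "real^'n^'n \<Rightarrow> real^'r^'n \<Rightarrow> bool" where
  "second_order_critical C Y \<longleftrightarrow>
     feasible Y \<and>
     riemannian_gradient (objective C) Y = 0 \<and>
     (\<forall>V\<in>tangent_space Y. frob V (riemannian_hessian (objective C) Y V) \<le> 0)"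


section \<open>The noise parameter\<close>

definition rho_at :: "real^'n^'n \<Rightarrow> real^'n \<Rightarrow> 'n \<Rightarrow> real" where
  "rho_at D z i = - z $ i * (\<Sum>j\<in>UNIV - {i}. D $ i $ j * z $ j)"

definition rho :: "real^'n^'n \<Rightarrow> real^'n \<Rightarrow> real" where
  "rho D z = Max (range (rho_at D z))"


section \<open>Consistency with the explicit characterizations\<close>

lemma frob_eq_inner: "frob A B = A \<bullet> B"
proof -
  have "frob A B = (\<Sum>j\<in>UNIV. \<Sum>i\<in>UNIV. A $ i $ j * B $ i $ j)"
    by (simp add: frob_def trace_def transpose_def matrix_matrix_mult_def)
  also have "\<dots> = A \<bullet> B"
    by (subst sum.swap) (simp add: inner_vec_def)
  finally show ?thesis .
qed

lemma ddiag_mult_nth: "(ddiag M ** Y) $ i = M $ i $ i *\<^sub>R (Y $ i)"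
  by (simp add: vec_eq_iff ddiag_def matrix_matrix_mult_def if_distrib if_distribR cong: if_cong)

lemma mult_transpose_nth: "(X ** transpose Y) $ i $ j = X $ i \<bullet> Y $ j"
  by (simp add: matrix_matrix_mult_def transpose_def inner_vec_def)

lemma feasible_iff: "feasible Y \<longleftrightarrow> (\<forall>i. norm (Y $ i) = 1)"
  by (auto simp: feasible_def ddiag_def mat_def vec_eq_iff mult_transpose_nth norm_eq_1)

lemma tangent_space_iff: "V \<in> tangent_space Y \<longleftrightarrow> (\<forall>i. Y $ i \<bullet> V $ i = 0)"
  by (auto simp: tangent_space_def ddiag_def vec_eq_iff mult_transpose_nth)

lemma proj_tangent_nth: "proj_tangent Y Z $ i = Z $ i - (Z $ i \<bullet> Y $ i) *\<^sub>R (Y $ i)"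
  by (simp add: proj_tangent_def ddiag_mult_nth mult_transpose_nth)

lemma proj_tangent_orthogonal:
  assumes "feasible Y"
  shows "proj_tangent Y Z \<in> tangent_space Y"
    and "V \<in> tangent_space Y \<Longrightarrow> frob V (Z - proj_tangent Y Z) = 0"
proof -
  have "Y $ i \<bullet> Y $ i = 1" for i
    using assms by (simp add: feasible_iff norm_eq_1)
  then show "proj_tangent Y Z \<in> tangent_space Y"
    by (simp add: tangent_space_iff proj_tangent_nth inner_diff_right inner_commute)
  show "V \<in> tangent_space Y \<Longrightarrow> frob V (Z - proj_tangent Y Z) = 0"
    by (simp add: frob_eq_inner inner_vec_def[of V] proj_tangent_nth tangent_space_iff
        inner_commute)
qed

lemma euclidean_gradient_eq: "GDERIV f Y :> g \<Longrightarrow> euclidean_gradient f Y = g"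
  unfolding euclidean_gradient_def
proof (rule the_equality)
  fix h assume "GDERIV f Y :> g" "GDERIV f Y :> h"
  then have "(\<lambda>k. k \<bullet> g) = (\<lambda>k. k \<bullet> h)"
    unfolding gderiv_def by (rule has_derivative_unique)
  then show "h = g" by (metis inner_commute vector_eq_rdot)
qed

lemma bounded_linear_matrix_mult_left: "bounded_linear (\<lambda>X. (M :: real^'n^'m) ** (X :: real^'r^'n))"
  by (intro linear_conv_bounded_linear[THEN iffD1] linearI)
     (simp_all add: vec_eq_iff matrix_matrix_mult_def sum.distrib algebra_simps sum_distrib_left)

lemma objective_eq: "objective C Y = (C ** Y) \<bullet> Y"
proof -
  have "objective C Y = (\<Sum>i\<in>UNIV. \<Sum>j\<in>UNIV. C $ i $ j * (Y $ i \<bullet> Y $ j))"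
    by (simp add: objective_def frob_eq_inner inner_vec_def[of C] inner_vec_def[of "C $ _"]
        mult_transpose_nth)
  also have "\<dots> = (C ** Y) \<bullet> Y"
  proof -
    have "(C ** Y) $ i \<bullet> Y $ i = (\<Sum>j\<in>UNIV. C $ i $ j * (Y $ i \<bullet> Y $ j))" for i
      unfolding inner_vec_def matrix_matrix_mult_def
      by (simp add: sum_distrib_left sum_distrib_right) (subst sum.swap, simp add: ac_simps)
    then show ?thesis by (simp add: inner_vec_def[of "C ** Y"])
  qed
  finally show ?thesis .
qed

lemma matrix_diff_mult_right: "((A :: real^'n^'m) - B) ** X = A ** X - B ** X"
  by (simp add: vec_eq_iff matrix_matrix_mult_def left_diff_distrib sum_subtractf)

lemma symmetric_mult_inner:
  fixes C :: "real^'n^'n" and X Y :: "real^'r^'n"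
  assumes "transpose C = C"
  shows "(C ** X) \<bullet> Y = X \<bullet> (C ** Y)"
proof -
  have "(C ** X) \<bullet> Y = trace (transpose (C ** X) ** Y)"
    by (simp add: frob_eq_inner[symmetric] frob_def)
  also have "\<dots> = trace (transpose X ** (C ** Y))"
    using assms by (simp add: matrix_transpose_mul matrix_mul_assoc)
  finally show ?thesis by (simp add: frob_eq_inner[symmetric] frob_def)
qed

lemma gderiv_objective:
  assumes "transpose C = C"
  shows "GDERIV (objective C) Y :> 2 *\<^sub>R (C ** Y)"
proof -
  have "((\<lambda>X. (C ** X) \<bullet> X) has_derivative (\<lambda>h. (C ** Y) \<bullet> h + (C ** h) \<bullet> Y)) (at Y)"
    by (intro has_derivative_inner bounded_linear.has_derivative[OF bounded_linear_matrix_mult_left]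
        has_derivative_ident)
  moreover have "(C ** Y) \<bullet> h + (C ** h) \<bullet> Y = h \<bullet> (2 *\<^sub>R (C ** Y))" for h
    using symmetric_mult_inner[OF assms, of h Y] by (simp add: inner_commute)
  ultimately show ?thesis
    unfolding gderiv_def by (simp add: objective_eq[abs_def])
qed

lemma has_derivative_rows:
  fixes f :: "'n::finite \<Rightarrow> 'a::real_normed_vector \<Rightarrow> 'b::euclidean_space"
  assumes "\<And>i. (f i has_derivative f' i) F"
  shows "((\<lambda>X. \<chi> i. f i X) has_derivative (\<lambda>h. \<chi> i. f' i h)) F"
proof -
  have "((\<lambda>X. (\<chi> i. f i X) \<bullet> e) has_derivative (\<lambda>h. (\<chi> i. f' i h) \<bullet> e)) F"
    if "e \<in> Basis" for e
  proof -
    obtain i b where e: "e = axis i b" using \<open>e \<in> Basis\<close> by (auto simp: Basis_vec_def)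
    show ?thesis using has_derivative_inner_left[OF assms] by (simp add: e inner_axis)
  qed
  then have "((\<lambda>X. \<Sum>e\<in>Basis. ((\<chi> i. f i X) \<bullet> e) *\<^sub>R e) has_derivative
      (\<lambda>h. \<Sum>e\<in>Basis. ((\<chi> i. f' i h) \<bullet> e) *\<^sub>R e)) F"
    by (intro has_derivative_sum has_derivative_scaleR_left)
  then show ?thesis by (simp only: euclidean_representation)
qed

lemma second_order_critical_iff:
  fixes C :: "real^'n^'n" and Y :: "real^'r^'n"
  assumes sym: "transpose C = C"
  defines "S \<equiv> ddiag (C ** Y ** transpose Y) - C"
  shows "second_order_critical C Y \<longleftrightarrow>
    feasible Y \<and> S ** Y = 0 \<and> (\<forall>V\<in>tangent_space Y. 0 \<le> frob S (V ** transpose V))"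
proof -
  have grad: "riemannian_gradient (objective C) X =
      2 *\<^sub>R (C ** X - ddiag (C ** X ** transpose X) ** X)" for X :: "real^'r^'n"
    by (simp add: riemannian_gradient_def euclidean_gradient_eq[OF gderiv_objective[OF sym]]
        vec_eq_iff proj_tangent_nth ddiag_mult_nth mult_transpose_nth algebra_simps)
  have SY: "riemannian_gradient (objective C) Y = - 2 *\<^sub>R (S ** Y)"
    by (simp add: grad S_def matrix_diff_mult_right algebra_simps)
  define G' where "G' h = 2 *\<^sub>R (C ** h - (\<chi> i. ((C ** Y) $ i \<bullet> Y $ i) *\<^sub>R (h $ i)
      + ((C ** Y) $ i \<bullet> h $ i + (C ** h) $ i \<bullet> Y $ i) *\<^sub>R (Y $ i)))" for h
  have "((\<lambda>X. 2 *\<^sub>R (C ** X - (\<chi> i. ((C ** X) $ i \<bullet> X $ i) *\<^sub>R (X $ i))))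
      has_derivative G') (at Y)"
    unfolding G'_def
    by (intro has_derivative_scaleR_right has_derivative_diff has_derivative_scaleR
        has_derivative_inner bounded_linear.has_derivative[OF bounded_linear_matrix_mult_left]
        has_derivative_ident has_derivative_rows
        bounded_linear.has_derivative[OF bounded_linear_vec_nth])
  moreover have "riemannian_gradient (objective C) =
      (\<lambda>X :: real^'r^'n. 2 *\<^sub>R (C ** X - (\<chi> i. ((C ** X) $ i \<bullet> X $ i) *\<^sub>R (X $ i))))"
    by (simp add: fun_eq_iff grad vec_eq_iff ddiag_mult_nth mult_transpose_nth)
  ultimately have D: "frechet_derivative (riemannian_gradient (objective C)) (at Y) = G'"
    using frechet_derivative_at by metis
  have H: "frob V (riemannian_hessian (objective C) Y V) = - 2 * frob S (V ** transpose V)"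
    if V: "V \<in> tangent_space Y" for V
  proof -
    have t: "V $ i \<bullet> Y $ i = 0" for i
      using V by (simp add: tangent_space_iff inner_commute)
    have "(S ** V) \<bullet> V = (\<Sum>i\<in>UNIV. (S ** V) $ i \<bullet> V $ i)"
      by (rule inner_vec_def)
    then have SV: "(S ** V) \<bullet> V =
        (\<Sum>i\<in>UNIV. ((C ** Y ** transpose Y) $ i $ i *\<^sub>R V $ i - (C ** V) $ i) \<bullet> V $ i)"
      by (simp add: S_def matrix_diff_mult_right ddiag_mult_nth)
    have "frob V (riemannian_hessian (objective C) Y V)
        = 2 * (\<Sum>i\<in>UNIV. V $ i \<bullet> (C ** V) $ i - ((C ** Y) $ i \<bullet> Y $ i) * (V $ i \<bullet> V $ i))"
      unfolding riemannian_hessian_def D G'_def frob_eq_inner inner_vec_def[of V]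
      by (simp add: proj_tangent_nth t inner_diff_right inner_add_right sum_distrib_left)
    also have "\<dots> = - 2 * ((S ** V) \<bullet> V)"
      by (simp only: SV) (simp add: mult_transpose_nth inner_diff_right sum_subtractf inner_commute)
    finally show ?thesis
      by (simp add: objective_eq[unfolded objective_def])
  qed
  show ?thesis
    unfolding second_order_critical_def SY by (auto simp: H)
qed

lemma poly_charpoly: "poly (charpoly A) x = det (mat x - A)"
  by (simp add: charpoly_def det_def poly_sum poly_prod mat_def if_distrib if_distribR cong: if_cong)

lemma det_mat_minus_eq_0_iff: "det (mat x - A) = 0 \<longleftrightarrow> (\<exists>v. v \<noteq> 0 \<and> A *v v = x *\<^sub>R v)"
  for A :: "real^'n^'n"
proof -
  have "mat x *v v = x *\<^sub>R v" for v :: "real^'n"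
    by (simp add: vec_eq_iff matrix_vector_mult_def mat_def if_distrib if_distribR cong: if_cong)
  then have "(mat x - A) *v v = x *\<^sub>R v - A *v v" for v
    by (simp add: matrix_vector_mult_diff_rdistrib)
  then have "(\<exists>v. v \<noteq> 0 \<and> A *v v = x *\<^sub>R v) \<longleftrightarrow> \<not> (\<forall>v. (mat x - A) *v v = 0 \<longrightarrow> v = 0)"
    by (metis eq_iff_diff_eq_0)
  also have "\<dots> \<longleftrightarrow> \<not> invertible (mat x - A)"
    using matrix_left_invertible_ker[of "mat x - A"] invertible_left_inverse[of "mat x - A"] by simp
  finally show ?thesis by (simp add: invertible_det_nz)
qed

lemma charpoly_nonzero: "charpoly A \<noteq> 0"
proof
  assume "charpoly A = 0"
  then have "det (mat (op_norm A + 1) - A) = 0" by (simp flip: poly_charpoly)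
  then obtain v where v: "v \<noteq> 0" "A *v v = (op_norm A + 1) *\<^sub>R v"
    by (auto simp: det_mat_minus_eq_0_iff)
  have bl: "bounded_linear ((*v) A)"
    by (simp add: matrix_vector_mul_bounded_linear)
  have "norm (A *v v) \<le> op_norm A * norm v"
    unfolding op_norm_def by (rule onorm[OF bl])
  moreover have "0 \<le> op_norm A" unfolding op_norm_def by (rule onorm_pos_le[OF bl])
  ultimately show False using v by simp
qed

lemma set_eigenvalues: "set (eigenvalues A) = {x. \<exists>v. v \<noteq> 0 \<and> A *v v = x *\<^sub>R v}"
  by (simp add: eigenvalues_def charpoly_nonzero poly_charpoly det_mat_minus_eq_0_iff)

end

theory Submission
  imports Defs
begin

text \<open>
  Multiplying row \<open>i\<close> of \<open>Y\<close> by \<open>z\<^sub>i\<close> gives unit vectors \<open>y\<^sub>i\<close>, the matrix \<open>C\<close> turns into \<open>A + D\<close> with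
  \<open>D\<^sub>i\<^sub>j = z\<^sub>i z\<^sub>j \<Delta>\<^sub>i\<^sub>j\<close>, and the claim becomes that all \<open>y\<^sub>i\<close> coincide.

  Moving all the \<open>y\<^sub>i\<close> at once in one common direction \<open>e\<close>, projected to the tangent spaces of the
  spheres, is the way to synchronize them. At a second-order critical point no such move increases
  the objective to second order. Averaging this over an orthonormal basis of directions \<open>e\<close>
  eliminates \<open>e\<close> (\<open>second_order_averaged\<close>): with \<open>q\<^sub>i\<^sub>j = 1 - y\<^sub>i \<bullet> y\<^sub>j = \<bar>y\<^sub>i - y\<^sub>j\<bar>\<^sup>2 / 2\<close>,
  the sum of \<open>(A\<^sub>i\<^sub>j + D\<^sub>i\<^sub>j) ((r - 3) q\<^sub>i\<^sub>j + q\<^sub>i\<^sub>j\<^sup>2)\<close> over all \<open>i, j\<close> is at most \<open>0\<close>.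

  If \<open>r = 3\<close> and \<open>\<Delta> = 0\<close>, then \<open>q\<close> vanishes on every edge, and connectedness finishes the proof.
  Otherwise write \<open>y\<^sub>i = m + w\<^sub>i\<close> with \<open>m\<close> the mean, and let \<open>s\<close> be the sum of the
  \<open>\<bar>w\<^sub>i\<bar>\<^sup>2\<close>; suppose \<open>s > 0\<close>. The graph part of the linear term is the Laplacian form of \<open>w\<close>, hence
  at least \<open>\<mu> s\<close>, where \<open>\<mu> > 0\<close> is the least value of the Rayleigh quotient on the vectors of sum zero
  (\<open>spectral_gap\<close>). Since \<open>\<mu>\<close> is an eigenvalue of the Laplacian, it is at least the algebraic
  connectivity. The graph part of the quadratic term is
  nonnegative. For the noise, expand \<open>q\<^sub>i\<^sub>j\<close> in \<open>\<bar>w\<^sub>i\<bar>\<^sup>2\<close>, \<open>\<bar>w\<^sub>j\<bar>\<^sup>2\<close> and \<open>w\<^sub>i \<bullet> w\<^sub>j\<close>: terms that depend on one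
  index only see the row sums of \<open>D\<close>, which are controlled by \<open>\<rho>\<close>, while the others are bilinear
  forms controlled by the operator norm \<open>\<delta>\<close>. As \<open>\<bar>w\<^sub>i\<bar> \<le> 2\<close>, the linear and the quadratic noise terms
  are at most \<open>(\<rho> + \<delta>) s\<close> and \<open>2 max(\<rho>, 0) s + 14 \<delta> s\<close> (\<open>noise_quadratic\<close>, \<open>noise_quartic\<close>).
  Together, \<open>(r - 3) \<mu> \<le> (r - 3) \<rho> + 2 max(\<rho>, 0) + (r + 11) \<delta>\<close>, which the assumed threshold
  excludes (\<open>threshold_arithmetic\<close>).
\<close>

(* Power series coefficients and vector entries share the infix dollar sign; all its uses below
   are vector entries. *)
no_notation fps_nth (infixl "$" 75)

section \<open>The spectral gap of a connected graph\<close>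

lemma connected_graph_constant:
  assumes "connected_graph A" and "\<And>i j. A $ i $ j \<noteq> 0 \<Longrightarrow> f i = f j"
  shows "f i = f j"
proof -
  have "(i, j) \<in> {(k, l). A $ k $ l \<noteq> 0}\<^sup>*"
    using assms(1) by (simp add: connected_graph_def)
  then show ?thesis
    by (induction rule: rtrancl_induct) (use assms(2) in auto)
qed

lemma adjacency_matrix_sym: "adjacency_matrix A \<Longrightarrow> A $ i $ j = A $ j $ i"
  unfolding adjacency_matrix_def by (metis transpose_def vec_lambda_beta)

lemma laplacian_mult_nth:
  "(laplacian A *v x) $ i = (\<Sum>j\<in>UNIV. A $ i $ j * (x $ i - x $ j))"
proof -
  have "(diag (A *v 1) *v x) $ i = (\<Sum>j\<in>UNIV. A $ i $ j) * x $ i"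
    by (simp add: diag_def matrix_vector_mult_def if_distrib if_distribR cong: if_cong)
  then show ?thesis
    by (simp add: laplacian_def matrix_vector_mult_diff_rdistrib right_diff_distrib
        sum_subtractf sum_distrib_right) (simp add: matrix_vector_mult_def)
qed

text \<open>The two variables are kept apart, so that the symmetry of the Laplacian can be read off as well
  as its positive semidefiniteness.\<close>

lemma inner_laplacian:
  assumes "adjacency_matrix A"
  shows "x \<bullet> (laplacian A *v y) =
    (\<Sum>i\<in>UNIV. \<Sum>j\<in>UNIV. A $ i $ j * ((x $ i - x $ j) * (y $ i - y $ j))) / 2"
proof -
  let ?S = "\<lambda>f. \<Sum>i\<in>UNIV. \<Sum>j\<in>UNIV. A $ i $ j * (f i j :: real)"
  have 1: "x \<bullet> (laplacian A *v y) = ?S (\<lambda>i j. x $ i * (y $ i - y $ j))"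
    by (simp add: inner_vec_def laplacian_mult_nth sum_distrib_left mult.left_commute)
  also have "\<dots> = ?S (\<lambda>i j. x $ j * (y $ j - y $ i))"
    by (subst sum.swap) (simp add: adjacency_matrix_sym[OF assms])
  finally have 2: "x \<bullet> (laplacian A *v y) = ?S (\<lambda>i j. x $ j * (y $ j - y $ i))" .
  have "?S (\<lambda>i j. (x $ i - x $ j) * (y $ i - y $ j)) =
      ?S (\<lambda>i j. x $ i * (y $ i - y $ j)) + ?S (\<lambda>i j. x $ j * (y $ j - y $ i))"
    by (simp add: sum.distrib[symmetric] algebra_simps)
  then show ?thesis using 1 2 by simp
qed

lemma quadratic_nonneg_imp_linear_zero:
  fixes b c :: real
  assumes "\<And>t. 0 \<le> 2 * t * b + t\<^sup>2 * c"
  shows "b = 0"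
proof (rule ccontr)
  assume "b \<noteq> 0"
  define s where "s = \<bar>c\<bar> + 1"
  define u where "u = b / s"
  have s: "s > 0" "c < 2 * s" by (auto simp: s_def)
  have b: "b = u * s" using s by (simp add: u_def)
  have "2 * (- u) * b + (- u)\<^sup>2 * c = u\<^sup>2 * (c - 2 * s)"
    by (simp add: b algebra_simps power2_eq_square)
  moreover have "u\<^sup>2 * (c - 2 * s) < 0"
    using s \<open>b \<noteq> 0\<close> by (simp add: u_def mult_pos_neg)
  ultimately show False using assms[of "- u"] by linarith
qed

text \<open>
  Minimizing the Rayleigh quotient over the vectors of sum zero, an invariant subspace of the
  Laplacian, yields an eigenvalue \<open>\<mu>\<close>. A minimizer of value zero would be constant along edges, hence
  zero, so \<open>\<mu>\<close> is positive. As \<open>0\<close> is an eigenvalue too, \<open>\<mu>\<close> is not the first entry of the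
  sorted list of eigenvalues, so the second entry is at most \<open>\<mu>\<close>. On a single vertex there is
  nothing to minimize over.
\<close>

lemma spectral_gap:
  fixes A :: "real^'n^'n"
  assumes adj: "adjacency_matrix A" and conn: "connected_graph A" and n: "CARD('n) \<noteq> 1"
  obtains \<mu> where "\<mu> > 0" and "algebraic_connectivity A \<le> \<mu>"
    and "\<And>x. (\<Sum>i\<in>UNIV. x $ i) = 0 \<Longrightarrow> \<mu> * (norm x)\<^sup>2 \<le> x \<bullet> (laplacian A *v x)"
proof -
  let ?L = "laplacian A"
  have sym: "x \<bullet> (?L *v y) = y \<bullet> (?L *v x)" for x y
    by (simp add: inner_laplacian[OF adj] mult.commute)
  define H where "H = {x :: real^'n. 1 \<bullet> x = 0}"
  have H_iff: "x \<in> H \<longleftrightarrow> (\<Sum>i\<in>UNIV. x $ i) = 0" for x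
    by (simp add: H_def inner_vec_def)
  have L1: "?L *v 1 = 0"
    by (simp add: vec_eq_iff laplacian_mult_nth)
  have LH: "?L *v x \<in> H" for x
    using sym[of 1 x] L1 by (simp add: H_def)
  have H_lin: "a *\<^sub>R x + b *\<^sub>R y \<in> H" if "x \<in> H" "y \<in> H" for a b x y
    using that by (simp add: H_def inner_add_right)
  define K where "K = sphere 0 1 \<inter> H"
  have "closed H" unfolding H_def by (rule closed_hyperplane)
  then have K: "compact K" by (simp add: K_def compact_Int_closed)
  have "K \<noteq> {}"
  proof -
    define i :: 'n where "i = undefined"
    have "UNIV \<noteq> {i}" using n by (metis is_singletonI is_singleton_altdef)
    then obtain j where "i \<noteq> j" by (metis UNIV_eq_I singletonI)
    define x :: "real^'n" where "x = axis i 1 - axis j 1"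
    have "x \<noteq> 0" using \<open>i \<noteq> j\<close> by (simp add: x_def axis_eq_axis)
    moreover have "x \<in> H" by (simp add: H_def x_def inner_diff_right inner_axis)
    ultimately have "x /\<^sub>R norm x \<in> K"
      by (simp add: K_def H_def)
    then show ?thesis by blast
  qed
  moreover have "continuous_on K (\<lambda>x. x \<bullet> (?L *v x))"
    by (intro continuous_intros matrix_vector_mult_linear_continuous_on)
  ultimately obtain v where v: "v \<in> K" and
    min: "\<And>x. x \<in> K \<Longrightarrow> v \<bullet> (?L *v v) \<le> x \<bullet> (?L *v x)"
    using continuous_attains_inf[OF K] by metis
  define \<mu> where "\<mu> = v \<bullet> (?L *v v)"
  have vH: "v \<in> H" and nv: "norm v = 1" using v by (auto simp: K_def)
  have rayleigh: "\<mu> * (norm x)\<^sup>2 \<le> x \<bullet> (?L *v x)" if "x \<in> H" for x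
  proof (cases "x = 0")
    case False
    then have "x /\<^sub>R norm x \<in> K" using that by (simp add: K_def H_def)
    from min[OF this] show ?thesis
      using False by (simp add: \<mu>_def matrix_vector_mult_scaleR field_simps power2_eq_square)
  qed simp
  have "\<mu> \<ge> 0"
    using adj by (auto simp: \<mu>_def inner_laplacian[OF adj] adjacency_matrix_def intro!: sum_nonneg)
  moreover have "\<mu> \<noteq> 0"
  proof
    assume "\<mu> = 0"
    then have "(\<Sum>i\<in>UNIV. \<Sum>j\<in>UNIV. A $ i $ j * ((v $ i - v $ j) * (v $ i - v $ j))) = 0"
      by (simp add: \<mu>_def inner_laplacian[OF adj])
    then have zero: "A $ i $ j * ((v $ i - v $ j) * (v $ i - v $ j)) = 0" for i j
      using adj by (simp add: sum_nonneg_eq_0_iff sum_nonneg adjacency_matrix_def)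
    have "v $ i = v $ j" for i j
      by (rule connected_graph_constant[OF conn, of "\<lambda>i. v $ i"]) (use zero in fastforce)
    then obtain c where c: "\<And>i. v $ i = c" by metis
    then have "v = 0" using vH by (simp add: H_iff vec_eq_iff)
    then show False using nv by simp
  qed
  ultimately have pos: "\<mu> > 0" by simp
  define w where "w = ?L *v v - \<mu> *\<^sub>R v"
  have wH: "w \<in> H" using H_lin[OF LH vH, of 1 v "- \<mu>"] by (simp add: w_def)
  \<comment> \<open>Perturb the minimizer in the direction of its own residual \<open>w\<close>: \<open>w \<bullet> w\<close> is the first-order
     coefficient of a form that is nonnegative on \<open>H\<close> and vanishes at \<open>v\<close>.\<close>
  have "w \<bullet> w = 0"
  proof (rule quadratic_nonneg_imp_linear_zero)
    fix t :: real
    have "v + t *\<^sub>R w \<in> H" using H_lin[OF vH wH, of 1 t] by simp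
    then have "\<mu> * ((v + t *\<^sub>R w) \<bullet> (v + t *\<^sub>R w)) \<le> (v + t *\<^sub>R w) \<bullet> (?L *v (v + t *\<^sub>R w))"
      using rayleigh by (metis power2_norm_eq_inner)
    moreover have "w \<bullet> (?L *v v) = w \<bullet> w + \<mu> * (w \<bullet> v)"
      by (simp add: w_def inner_diff_right)
    moreover have "v \<bullet> v = 1" using nv by (simp add: norm_eq_1)
    ultimately show "0 \<le> 2 * t * (w \<bullet> w) + t\<^sup>2 * (w \<bullet> (?L *v w) - \<mu> * (w \<bullet> w))"
      using sym[of v w] \<mu>_def
      by (simp add: matrix_vector_right_distrib matrix_vector_mult_scaleR inner_add_left
          inner_add_right algebra_simps power2_eq_square inner_commute[of v w])
  qed
  then have eig: "?L *v v = \<mu> *\<^sub>R v" by (simp add: w_def)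
  have "v \<noteq> 0" using nv by auto
  then have mu: "\<mu> \<in> set (eigenvalues ?L)"
    unfolding set_eigenvalues using eig by blast
  have zero: "0 \<in> set (eigenvalues ?L)"
    unfolding set_eigenvalues using L1 by (auto intro!: exI[of _ 1])
  have "algebraic_connectivity A \<le> \<mu>"
  proof -
    have srt: "sorted (eigenvalues ?L)" by (simp add: eigenvalues_def)
    obtain k where k: "k < length (eigenvalues ?L)" "eigenvalues ?L ! k = \<mu>"
      using mu by (metis in_set_conv_nth)
    obtain l where l: "l < length (eigenvalues ?L)" "eigenvalues ?L ! l = 0"
      using zero by (metis in_set_conv_nth)
    have "k \<noteq> 0"
      using sorted_nth_mono[OF srt, of 0 l] k l pos by (cases k) auto
    then show ?thesis
      using sorted_nth_mono[OF srt, of 1 k] k by (simp add: algebraic_connectivity_def)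
  qed
  then show thesis using that pos rayleigh H_iff by blast
qed

lemma spectral_gap_rows:
  fixes w :: "'n::finite \<Rightarrow> real^'r" and A :: "real^'n^'n"
  assumes adj: "adjacency_matrix A"
    and gap: "\<And>x. (\<Sum>i\<in>UNIV. x $ i) = 0 \<Longrightarrow> \<mu> * (norm x)\<^sup>2 \<le> x \<bullet> (laplacian A *v x)"
    and w: "(\<Sum>i\<in>UNIV. w i) = 0"
  shows "\<mu> * (\<Sum>i\<in>UNIV. (norm (w i))\<^sup>2) \<le>
    (\<Sum>i\<in>UNIV. \<Sum>j\<in>UNIV. A $ i $ j * ((norm (w i - w j))\<^sup>2 / 2))"
proof -
  define c where "c k = (\<chi> i. w i $ k)" for k
  have "\<mu> * (norm (c k))\<^sup>2 \<le> c k \<bullet> (laplacian A *v c k)" for k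
    using w by (intro gap) (simp add: c_def vec_eq_iff)
  then have "(\<Sum>k\<in>UNIV. \<mu> * (norm (c k))\<^sup>2) \<le> (\<Sum>k\<in>UNIV. c k \<bullet> (laplacian A *v c k))"
    by (intro sum_mono)
  moreover have "(\<Sum>k\<in>UNIV. \<mu> * (norm (c k))\<^sup>2) = \<mu> * (\<Sum>i\<in>UNIV. (norm (w i))\<^sup>2)"
    unfolding power2_norm_eq_inner inner_vec_def c_def
    by (subst sum.swap) (simp add: sum_distrib_left)
  moreover have "(\<Sum>k\<in>UNIV. c k \<bullet> (laplacian A *v c k)) =
      (\<Sum>i\<in>UNIV. \<Sum>j\<in>UNIV. A $ i $ j * ((norm (w i - w j))\<^sup>2 / 2))"
  proof -
    let ?T = "\<lambda>i j k. A $ i $ j * ((w i $ k - w j $ k) * (w i $ k - w j $ k)) / 2"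
    have "(\<Sum>k\<in>UNIV. c k \<bullet> (laplacian A *v c k)) =
        (\<Sum>k\<in>UNIV. \<Sum>i\<in>UNIV. \<Sum>j\<in>UNIV. ?T i j k)"
      by (simp add: inner_laplacian[OF adj] c_def sum_divide_distrib)
    also have "\<dots> = (\<Sum>i\<in>UNIV. \<Sum>k\<in>UNIV. \<Sum>j\<in>UNIV. ?T i j k)"
      by (rule sum.swap)
    also have "\<dots> = (\<Sum>i\<in>UNIV. \<Sum>j\<in>UNIV. \<Sum>k\<in>UNIV. ?T i j k)"
      by (intro sum.cong refl sum.swap)
    finally show ?thesis
      unfolding power2_norm_eq_inner inner_vec_def
      by (simp add: sum_divide_distrib sum_distrib_left)
  qed
  ultimately show ?thesis by linarith
qed


section \<open>The averaged second-order condition\<close>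

text \<open>
  Test the second-order condition with the rows \<open>V\<^sub>i = z\<^sub>i P\<^sub>i e\<close>, where \<open>P\<^sub>i\<close> is the projection onto the
  orthogonal complement of \<open>Y\<^sub>i\<close>, and sum over an orthonormal basis of vectors \<open>e\<close>. The inner products
  \<open>V\<^sub>i \<bullet> V\<^sub>j\<close> add up to \<open>z\<^sub>i z\<^sub>j\<close> times the trace of \<open>P\<^sub>i P\<^sub>j\<close>, which is \<open>r - 2 + t\<^sub>i\<^sub>j\<^sup>2\<close> and on the
  diagonal \<open>r - 1\<close>. Since the diagonal of \<open>ddiag (C Y Y\<^sup>T)\<close> consists of row sums of
  \<open>z\<^sub>i z\<^sub>j C\<^sub>i\<^sub>j t\<^sub>i\<^sub>j\<close>, each pair contributes \<open>(r - 1) t - (r - 2) - t\<^sup>2 = - (1 - t) (r - 2 - t)\<close>.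
\<close>

lemma second_order_averaged:
  fixes C :: "real^'n^'n" and Y :: "real^'r^'n" and z :: "real^'n"
  assumes sym: "transpose C = C" and z: "\<And>i. z $ i \<in> {-1, 1}"
    and crit: "second_order_critical C Y"
  defines "t \<equiv> \<lambda>i j. (z $ i *\<^sub>R Y $ i) \<bullet> (z $ j *\<^sub>R Y $ j)"
  shows "(\<Sum>i\<in>UNIV. \<Sum>j\<in>UNIV. z $ i * z $ j * C $ i $ j *
           ((1 - t i j) * (real CARD('r) - 2 - t i j))) \<le> 0"
proof -
  define V :: "real^'r \<Rightarrow> real^'r^'n"
    where "V e = (\<chi> i. z $ i *\<^sub>R (e - (e \<bullet> Y $ i) *\<^sub>R Y $ i))" for e
  let ?S = "ddiag (C ** Y ** transpose Y) - C"
  have Y1: "Y $ i \<bullet> Y $ i = 1" for i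
    using crit by (simp add: second_order_critical_def feasible_iff norm_eq_1)
  have zz: "z $ i * z $ i = 1" for i using z[of i] by auto
  have "V e \<in> tangent_space Y" for e
    by (simp add: tangent_space_iff V_def inner_diff_right Y1 inner_commute)
  then have "0 \<le> frob ?S (V e ** transpose (V e))" for e
    using crit by (simp add: second_order_critical_iff[OF sym])
  then have "0 \<le> (\<Sum>e\<in>Basis. frob ?S (V e ** transpose (V e)))"
    by (intro sum_nonneg)
  also have "\<dots> = (\<Sum>e\<in>Basis. \<Sum>i\<in>UNIV. \<Sum>j\<in>UNIV. ?S $ i $ j * (V e $ i \<bullet> V e $ j))"
    by (simp add: frob_eq_inner inner_vec_def[of ?S] inner_vec_def[of "?S $ _"]
        mult_transpose_nth del: vector_minus_component)
  also have "\<dots> = (\<Sum>i\<in>UNIV. \<Sum>e\<in>Basis. \<Sum>j\<in>UNIV. ?S $ i $ j * (V e $ i \<bullet> V e $ j))"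
    by (rule sum.swap)
  also have "\<dots> = (\<Sum>i\<in>UNIV. \<Sum>j\<in>UNIV. \<Sum>e\<in>Basis. ?S $ i $ j * (V e $ i \<bullet> V e $ j))"
    by (intro sum.cong refl sum.swap)
  also have "\<dots> = (\<Sum>i\<in>UNIV. \<Sum>j\<in>UNIV. ?S $ i $ j * (z $ i * z $ j * (real CARD('r) - 2 + (t i j)\<^sup>2)))"
  proof (intro sum.cong refl)
    fix i j
    have e: "V e $ i \<bullet> V e $ j = z $ i * z $ j * (e \<bullet> e - (Y $ i \<bullet> e) * (Y $ i \<bullet> e)
        - (Y $ j \<bullet> e) * (Y $ j \<bullet> e) + (Y $ i \<bullet> Y $ j) * ((Y $ i \<bullet> e) * (Y $ j \<bullet> e)))" for e
      by (simp add: V_def inner_diff_left inner_diff_right algebra_simps inner_commute)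
    have "(\<Sum>e\<in>Basis. V e $ i \<bullet> V e $ j) = z $ i * z $ j * (real CARD('r) - 2 + (Y $ i \<bullet> Y $ j)\<^sup>2)"
      unfolding e sum_distrib_left[symmetric] sum.distrib sum_subtractf
        euclidean_inner[symmetric]
      by (simp add: Y1 power2_eq_square)
    moreover have "(t i j)\<^sup>2 = (Y $ i \<bullet> Y $ j)\<^sup>2"
      using z[of i] z[of j] by (auto simp: t_def)
    ultimately show "(\<Sum>e\<in>Basis. ?S $ i $ j * (V e $ i \<bullet> V e $ j)) =
        ?S $ i $ j * (z $ i * z $ j * (real CARD('r) - 2 + (t i j)\<^sup>2))"
      by (simp add: sum_distrib_left[symmetric] del: vector_minus_component)
  qed
  also have "\<dots> = (\<Sum>i\<in>UNIV. (\<Sum>j\<in>UNIV. C $ i $ j * (z $ i * z $ j * t i j)) * (real CARD('r) - 1)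
      - (\<Sum>j\<in>UNIV. C $ i $ j * (z $ i * z $ j * (real CARD('r) - 2 + (t i j)\<^sup>2))))"
  proof (intro sum.cong refl)
    fix i
    have tii: "t i i = 1" by (simp add: t_def zz Y1 mult.assoc[symmetric])
    have "z $ i * z $ j * t i j = Y $ i \<bullet> Y $ j" for j
      using z[of i] z[of j] by (auto simp: t_def)
    moreover have "(C ** Y) $ i = (\<Sum>j\<in>UNIV. C $ i $ j *\<^sub>R Y $ j)"
      by (simp add: vec_eq_iff matrix_matrix_mult_def)
    ultimately have d: "(C ** Y ** transpose Y) $ i $ i =
        (\<Sum>j\<in>UNIV. C $ i $ j * (z $ i * z $ j * t i j))"
      by (simp add: mult_transpose_nth inner_sum_left inner_commute[of "Y $ i"])
    have "(\<Sum>j\<in>UNIV. ?S $ i $ j * (z $ i * z $ j * (real CARD('r) - 2 + (t i j)\<^sup>2))) =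
      (\<Sum>j\<in>UNIV. (if i = j then (C ** Y ** transpose Y) $ i $ i * (real CARD('r) - 1) else 0)
        - C $ i $ j * (z $ i * z $ j * (real CARD('r) - 2 + (t i j)\<^sup>2)))"
      by (intro sum.cong refl) (auto simp: ddiag_def tii zz left_diff_distrib)
    then show "(\<Sum>j\<in>UNIV. ?S $ i $ j * (z $ i * z $ j * (real CARD('r) - 2 + (t i j)\<^sup>2))) =
      (\<Sum>j\<in>UNIV. C $ i $ j * (z $ i * z $ j * t i j)) * (real CARD('r) - 1)
      - (\<Sum>j\<in>UNIV. C $ i $ j * (z $ i * z $ j * (real CARD('r) - 2 + (t i j)\<^sup>2)))"
      by (simp add: sum_subtractf d)
  qed
  also have "\<dots> = - (\<Sum>i\<in>UNIV. \<Sum>j\<in>UNIV. z $ i * z $ j * C $ i $ j *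
           ((1 - t i j) * (real CARD('r) - 2 - t i j)))"
    unfolding sum_distrib_right sum_subtractf[symmetric] sum_negf[symmetric]
    by (intro sum.cong refl) (simp add: algebra_simps power2_eq_square)
  finally show ?thesis by simp
qed


section \<open>Estimates for the noise\<close>

lemma op_norm_bilinear: "\<bar>x \<bullet> (M *v y)\<bar> \<le> op_norm M * norm x * norm y"
proof -
  have "norm (M *v y) \<le> op_norm M * norm y"
    unfolding op_norm_def by (rule onorm) (rule matrix_vector_mul_bounded_linear)
  then have "norm x * norm (M *v y) \<le> norm x * (op_norm M * norm y)"
    by (rule mult_left_mono) simp
  then show ?thesis
    using Cauchy_Schwarz_ineq2[of x "M *v y"] by (simp add: mult_ac)
qed

lemma op_norm_nonneg: "0 \<le> op_norm M"
  unfolding op_norm_def by (rule onorm_pos_le) (rule matrix_vector_mul_bounded_linear)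

lemma sym_double_sum_swap:
  fixes D :: "real^'n^'n"
  assumes "\<And>i j. D $ i $ j = D $ j $ i"
  shows "(\<Sum>i\<in>UNIV. \<Sum>j\<in>UNIV. D $ i $ j * f j i) = (\<Sum>i\<in>UNIV. \<Sum>j\<in>UNIV. D $ i $ j * f i j)"
  by (subst sum.swap) (simp add: assms)

text \<open>The bound is applied coordinate by coordinate, so the vectors may live in any Euclidean space:
  below it is the real line, the space of the rows, and a space of matrices. It is symmetric in \<open>p\<close> and
  \<open>q\<close>; a different weighting is obtained by scaling them in opposite directions.\<close>

lemma bilinear_form_bound:
  fixes D :: "real^'n^'n" and p q :: "'n \<Rightarrow> 'e::euclidean_space"
  assumes op: "\<And>x y. \<bar>x \<bullet> (D *v y)\<bar> \<le> \<delta> * norm x * norm y" and "0 \<le> \<delta>"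
  shows "\<bar>\<Sum>i\<in>UNIV. \<Sum>j\<in>UNIV. D $ i $ j * (p i \<bullet> q j)\<bar>
    \<le> \<delta> * (((\<Sum>i\<in>UNIV. (norm (p i))\<^sup>2) + (\<Sum>i\<in>UNIV. (norm (q i))\<^sup>2)) / 2)"
proof -
  define P where "P b = (\<chi> i. p i \<bullet> b)" for b
  define Q where "Q b = (\<chi> i. q i \<bullet> b)" for b
  have norms: "(\<Sum>b\<in>Basis. (norm (\<chi> i. f i \<bullet> b))\<^sup>2) = (\<Sum>i\<in>UNIV. (norm (f i))\<^sup>2)"
    for f :: "'n \<Rightarrow> 'e"
    unfolding power2_norm_eq_inner inner_vec_def
    by (subst sum.swap) (simp add: euclidean_inner[symmetric])
  have "(\<Sum>b\<in>Basis. P b \<bullet> (D *v Q b)) =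
      (\<Sum>b\<in>Basis. \<Sum>i\<in>UNIV. \<Sum>j\<in>UNIV. D $ i $ j * ((p i \<bullet> b) * (q j \<bullet> b)))"
    by (simp add: P_def Q_def inner_vec_def matrix_vector_mult_def sum_distrib_left mult_ac)
  also have "\<dots> = (\<Sum>i\<in>UNIV. \<Sum>b\<in>Basis. \<Sum>j\<in>UNIV. D $ i $ j * ((p i \<bullet> b) * (q j \<bullet> b)))"
    by (rule sum.swap)
  also have "\<dots> = (\<Sum>i\<in>UNIV. \<Sum>j\<in>UNIV. \<Sum>b\<in>Basis. D $ i $ j * ((p i \<bullet> b) * (q j \<bullet> b)))"
    by (intro sum.cong refl sum.swap)
  also have "\<dots> = (\<Sum>i\<in>UNIV. \<Sum>j\<in>UNIV. D $ i $ j * (p i \<bullet> q j))"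
    by (simp add: sum_distrib_left[symmetric] euclidean_inner[symmetric])
  finally have "\<bar>\<Sum>i\<in>UNIV. \<Sum>j\<in>UNIV. D $ i $ j * (p i \<bullet> q j)\<bar> \<le> (\<Sum>b\<in>Basis. \<bar>P b \<bullet> (D *v Q b)\<bar>)"
    by (metis sum_abs)
  also have "\<dots> \<le> (\<Sum>b\<in>Basis. \<delta> * (((norm (P b))\<^sup>2 + (norm (Q b))\<^sup>2) / 2))"
  proof (intro sum_mono)
    fix b :: 'e
    have "norm (P b) * norm (Q b) \<le> ((norm (P b))\<^sup>2 + (norm (Q b))\<^sup>2) / 2"
      using sum_squares_bound[of "norm (P b)" "norm (Q b)"] by simp
    then have "\<delta> * (norm (P b) * norm (Q b)) \<le> \<delta> * (((norm (P b))\<^sup>2 + (norm (Q b))\<^sup>2) / 2)"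
      using \<open>0 \<le> \<delta>\<close> by (rule mult_left_mono)
    then show "\<bar>P b \<bullet> (D *v Q b)\<bar> \<le> \<delta> * (((norm (P b))\<^sup>2 + (norm (Q b))\<^sup>2) / 2)"
      using op[of "P b" "Q b"] by (simp add: mult.assoc)
  qed
  also have "\<dots> = \<delta> * (((\<Sum>i\<in>UNIV. (norm (p i))\<^sup>2) + (\<Sum>i\<in>UNIV. (norm (q i))\<^sup>2)) / 2)"
    using norms[of p] norms[of q]
    by (simp add: P_def Q_def sum_distrib_left[symmetric] sum_divide_distrib[symmetric] sum.distrib)
  finally show ?thesis .
qed

lemma row_sum_bound:
  fixes D :: "real^'n^'n"
  assumes rho: "\<And>i. - (\<Sum>j\<in>UNIV. D $ i $ j) \<le> \<rho>" and "\<And>i. 0 \<le> b i"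
  shows "- (\<Sum>i\<in>UNIV. \<Sum>j\<in>UNIV. D $ i $ j * b i) \<le> \<rho> * (\<Sum>i\<in>UNIV. b i)"
proof -
  have "(\<Sum>i\<in>UNIV. - (\<Sum>j\<in>UNIV. D $ i $ j) * b i) \<le> (\<Sum>i\<in>UNIV. \<rho> * b i)"
    using assms by (intro sum_mono mult_right_mono) auto
  then show ?thesis
    by (simp add: sum_distrib_left[symmetric] sum_distrib_right[symmetric] sum_negf)
qed

lemma half_norm_diff_squared:
  "(norm (v - w))\<^sup>2 / 2 = ((norm v)\<^sup>2 + (norm w)\<^sup>2) / 2 - v \<bullet> w"
  by (simp add: power2_norm_eq_inner inner_diff_left inner_diff_right inner_commute)

text \<open>The squares \<open>\<bar>w\<^sub>i\<bar>\<^sup>2\<close> and \<open>\<bar>w\<^sub>j\<bar>\<^sup>2\<close> meet the row sums of \<open>D\<close>, the mixed term \<open>w\<^sub>i \<bullet> w\<^sub>j\<close> its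
  norm.\<close>

lemma noise_quadratic:
  fixes D :: "real^'n^'n" and w :: "'n \<Rightarrow> real^'r"
  assumes sym: "\<And>i j. D $ i $ j = D $ j $ i"
    and op: "\<And>x y. \<bar>x \<bullet> (D *v y)\<bar> \<le> \<delta> * norm x * norm y" and "0 \<le> \<delta>"
    and rho: "\<And>i. - (\<Sum>j\<in>UNIV. D $ i $ j) \<le> \<rho>"
  shows "- (\<Sum>i\<in>UNIV. \<Sum>j\<in>UNIV. D $ i $ j * ((norm (w i - w j))\<^sup>2 / 2))
    \<le> (\<rho> + \<delta>) * (\<Sum>i\<in>UNIV. (norm (w i))\<^sup>2)"
proof -
  define a where "a i = (norm (w i))\<^sup>2" for i
  let ?S = "\<lambda>f. \<Sum>i\<in>UNIV. \<Sum>j\<in>UNIV. D $ i $ j * (f i j :: real)"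
  have "?S (\<lambda>i j. (norm (w i - w j))\<^sup>2 / 2) = ?S (\<lambda>i j. a i) / 2 + ?S (\<lambda>i j. a j) / 2 - ?S (\<lambda>i j. w i \<bullet> w j)"
    unfolding half_norm_diff_squared a_def sum_divide_distrib sum.distrib[symmetric]
      sum_subtractf[symmetric]
    by (intro sum.cong refl) (simp add: field_simps)
  also have "?S (\<lambda>i j. a j) = ?S (\<lambda>i j. a i)"
    by (rule sym_double_sum_swap[OF sym])
  finally have "- ?S (\<lambda>i j. (norm (w i - w j))\<^sup>2 / 2) = - ?S (\<lambda>i j. a i) + ?S (\<lambda>i j. w i \<bullet> w j)"
    by simp
  moreover have "- ?S (\<lambda>i j. a i) \<le> \<rho> * sum a UNIV"
    using rho by (rule row_sum_bound) (simp add: a_def)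
  moreover have "?S (\<lambda>i j. w i \<bullet> w j) \<le> \<delta> * sum a UNIV"
    using bilinear_form_bound[OF op \<open>0 \<le> \<delta>\<close>, of w w] by (simp add: a_def)
  ultimately show ?thesis
    unfolding a_def[symmetric] distrib_right by linarith
qed

text \<open>
  With \<open>a\<^sub>i = \<bar>w\<^sub>i\<bar>\<^sup>2\<close> and \<open>g\<^sub>i\<^sub>j = w\<^sub>i \<bullet> w\<^sub>j\<close>, symmetry of \<open>D\<close> turns the summand into
  \<open>a\<^sub>i\<^sup>2 / 2 + a\<^sub>i a\<^sub>j / 2 + g\<^sub>i\<^sub>j\<^sup>2 - 2 a\<^sub>i g\<^sub>i\<^sub>j\<close>. The first term sees row sums; the other three are
  bilinear forms and, as \<open>a\<^sub>i \<le> 4\<close>, cost \<open>2\<close>, \<open>4\<close> and \<open>8\<close> times \<open>\<delta>\<close>, which explains the constant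
  \<open>14\<close>. The fourth powers are kept next to \<open>\<rho>\<close>: replacing them by \<open>4 \<bar>w\<^sub>i\<bar>\<^sup>2\<close> would be
  wrong for negative \<open>\<rho>\<close>.
\<close>

lemma noise_quartic:
  fixes D :: "real^'n^'n" and w :: "'n \<Rightarrow> real^'r"
  assumes sym: "\<And>i j. D $ i $ j = D $ j $ i"
    and op: "\<And>x y. \<bar>x \<bullet> (D *v y)\<bar> \<le> \<delta> * norm x * norm y" and "0 \<le> \<delta>"
    and rho: "\<And>i. - (\<Sum>j\<in>UNIV. D $ i $ j) \<le> \<rho>"
    and bounded: "\<And>i. norm (w i) \<le> 2"
  shows "- (\<Sum>i\<in>UNIV. \<Sum>j\<in>UNIV. D $ i $ j * ((norm (w i - w j))\<^sup>2 / 2)\<^sup>2)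
    \<le> \<rho> / 2 * (\<Sum>i\<in>UNIV. (norm (w i)) ^ 4) + 14 * \<delta> * (\<Sum>i\<in>UNIV. (norm (w i))\<^sup>2)"
proof -
  define a where "a i = (norm (w i))\<^sup>2" for i
  let ?S = "\<lambda>f. \<Sum>i\<in>UNIV. \<Sum>j\<in>UNIV. D $ i $ j * (f i j :: real)"
  let ?a1 = "\<Sum>i\<in>UNIV. a i" and ?a2 = "\<Sum>i\<in>UNIV. (a i)\<^sup>2" and ?a3 = "\<Sum>i\<in>UNIV. (a i) ^ 3"
  have a: "0 \<le> a i" "a i \<le> 4" for i
    using power_mono[OF bounded, of i 2] by (simp_all add: a_def)
  have a2: "?a2 \<le> 4 * ?a1"
    unfolding sum_distrib_left power2_eq_square by (intro sum_mono mult_right_mono a)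
  have a3: "?a3 \<le> 16 * ?a1"
    unfolding sum_distrib_left
  proof (intro sum_mono)
    fix i
    have "(a i)\<^sup>2 * a i \<le> 4\<^sup>2 * a i"
      using a by (intro mult_right_mono power_mono)
    then show "a i ^ 3 \<le> 16 * a i" by (simp add: power3_eq_cube power2_eq_square)
  qed
  have square: "((x + y) / 2 - g)\<^sup>2 = x\<^sup>2 / 4 + y\<^sup>2 / 4 + x * y / 2 + g\<^sup>2 - x * g - y * g"
    for x y g :: real
    by (simp add: power2_eq_square field_simps)
  have "?S (\<lambda>i j. ((norm (w i - w j))\<^sup>2 / 2)\<^sup>2) =
      ?S (\<lambda>i j. (a i)\<^sup>2) / 4 + ?S (\<lambda>i j. (a j)\<^sup>2) / 4 + ?S (\<lambda>i j. a i * a j) / 2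
      + ?S (\<lambda>i j. (w i \<bullet> w j)\<^sup>2) - ?S (\<lambda>i j. a i * (w i \<bullet> w j)) - ?S (\<lambda>i j. a j * (w j \<bullet> w i))"
    unfolding half_norm_diff_squared a_def[symmetric] sum_divide_distrib sum.distrib[symmetric]
      sum_subtractf[symmetric] square
    by (simp only: distrib_left right_diff_distrib times_divide_eq_right inner_commute)
  also have "?S (\<lambda>i j. (a j)\<^sup>2) = ?S (\<lambda>i j. (a i)\<^sup>2)"
    by (rule sym_double_sum_swap[OF sym])
  also have "?S (\<lambda>i j. a j * (w j \<bullet> w i)) = ?S (\<lambda>i j. a i * (w i \<bullet> w j))"
    by (rule sym_double_sum_swap[OF sym])
  finally have expand: "?S (\<lambda>i j. ((norm (w i - w j))\<^sup>2 / 2)\<^sup>2) =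
      ?S (\<lambda>i j. (a i)\<^sup>2) / 2 + ?S (\<lambda>i j. a i * a j) / 2
      + ?S (\<lambda>i j. (w i \<bullet> w j)\<^sup>2) - 2 * ?S (\<lambda>i j. a i * (w i \<bullet> w j))"
    by simp
  note bound = bilinear_form_bound[OF op \<open>0 \<le> \<delta>\<close>]
  have b1: "- ?S (\<lambda>i j. (a i)\<^sup>2) \<le> \<rho> * ?a2"
    using rho by (rule row_sum_bound) simp
  have b2: "- ?S (\<lambda>i j. a i * a j) \<le> \<delta> * ?a2"
    using bound[of a a] by simp
  have b3: "- ?S (\<lambda>i j. (w i \<bullet> w j)\<^sup>2) \<le> \<delta> * ?a2"
  proof -
    \<comment> \<open>Squared inner products are inner products of tensor squares.\<close>
    define W :: "'n \<Rightarrow> real^'r^'r" where "W i = (\<chi> k. (w i $ k) *\<^sub>R w i)" for i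
    have W: "W i \<bullet> W j = (w i \<bullet> w j)\<^sup>2" for i j
    proof -
      have "W i \<bullet> W j = (\<Sum>k\<in>UNIV. (w i $ k * w j $ k) * (w i \<bullet> w j))"
        unfolding inner_vec_def[of "W i"] by (simp add: W_def mult_ac)
      also have "\<dots> = (\<Sum>k\<in>UNIV. w i $ k * w j $ k) * (w i \<bullet> w j)"
        by (rule sum_distrib_right[symmetric])
      also have "(\<Sum>k\<in>UNIV. w i $ k * w j $ k) = w i \<bullet> w j"
        by (simp add: inner_vec_def)
      finally show ?thesis by (simp add: power2_eq_square)
    qed
    then have "(norm (W i))\<^sup>2 = (a i)\<^sup>2" for i
      by (simp add: power2_norm_eq_inner a_def)
    then show ?thesis using bound[of W W] by (simp add: W)
  qed
  have b4: "4 * ?S (\<lambda>i j. a i * (w i \<bullet> w j)) \<le> \<delta> * ((?a3 + 16 * ?a1) / 2)"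
  proof -
    \<comment> \<open>The factor \<open>4\<close> balances the two sides: \<open>a\<^sub>i\<^sup>3\<close> and \<open>16 a\<^sub>i\<close> agree at the extreme value \<open>a\<^sub>i = 4\<close>.\<close>
    have "(norm (a i *\<^sub>R w i))\<^sup>2 = a i ^ 3" "(norm (4 *\<^sub>R w i))\<^sup>2 = 16 * a i" for i
      by (simp_all add: a_def power_mult_distrib power3_eq_cube power2_eq_square)
    then show ?thesis
      using bound[of "\<lambda>i. a i *\<^sub>R w i" "\<lambda>j. 4 *\<^sub>R w j"]
      by (simp only: inner_scaleR_left inner_scaleR_right sum_distrib_left[symmetric]
          mult.left_commute[of _ 4])
  qed
  have "\<delta> * ?a2 \<le> \<delta> * (4 * ?a1)"
    using a2 \<open>0 \<le> \<delta>\<close> by (rule mult_left_mono)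
  moreover have "\<delta> * ((?a3 + 16 * ?a1) / 2) \<le> \<delta> * (16 * ?a1)"
    using a3 by (intro mult_left_mono \<open>0 \<le> \<delta>\<close>) simp
  moreover have "(\<Sum>i\<in>UNIV. (norm (w i)) ^ 4) = ?a2" "(\<Sum>i\<in>UNIV. (norm (w i))\<^sup>2) = ?a1"
    by (simp_all add: a_def)
  ultimately show ?thesis
    unfolding expand using b1 b2 b3 b4 by simp
qed


section \<open>The spectral gap against the noise\<close>

text \<open>
  Here \<open>\<kappa>\<close> is the algebraic connectivity, \<open>\<mu>\<close> the spectral gap, and \<open>s\<close> and \<open>f\<close> are the sums of
  \<open>\<bar>w\<^sub>i\<bar>\<^sup>2\<close> and \<open>\<bar>w\<^sub>i\<bar>\<^sup>4\<close>. Multiplied by \<open>r - 1\<close>, the threshold says that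
  \<open>(r - 1) \<rho> + (r - 1) e \<le> (r - 3) \<mu>\<close> with \<open>e = (r + 11) \<delta> / (r - 3)\<close>. If \<open>\<rho> \<ge> 0\<close>, the left side
  of the claim is at most \<open>(r - 1) \<rho> + (r - 3) e\<close> times \<open>s\<close>, and here \<open>e\<close> has the smaller factor; in the
  noiseless case, where \<open>e = 0\<close>, strictness comes from \<open>\<mu> > 0\<close> instead. If \<open>\<rho> < 0\<close>, the quartic
  term can be dropped, and \<open>\<rho> + e\<close> only has to be multiplied by \<open>r - 3\<close> instead of \<open>r - 1\<close>.
\<close>

lemma threshold_arithmetic:
  fixes \<rho> \<delta> \<mu> \<kappa> r s f :: real
  assumes r: "3 < r" and "0 \<le> \<delta>" and "\<delta> = 0 \<Longrightarrow> \<rho> = 0" and "0 < \<mu>" "\<kappa> \<le> \<mu>"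
    and s: "0 < s" and f: "0 \<le> f" "f \<le> 4 * s"
    and thr: "\<rho> + (r + 11) / (r - 3) * \<delta> \<le> (r - 3) / (r - 1) * \<kappa>"
  shows "(r - 3) * ((\<rho> + \<delta>) * s) + (\<rho> / 2 * f + 14 * \<delta> * s) < (r - 3) * (\<mu> * s)"
proof -
  define e where "e = (r + 11) / (r - 3) * \<delta>"
  have e: "(r + 11) * \<delta> = (r - 3) * e" using r by (simp add: e_def)
  have "(r - 3) / (r - 1) * \<kappa> \<le> (r - 3) / (r - 1) * \<mu>"
    using r \<open>\<kappa> \<le> \<mu>\<close> by (intro mult_left_mono) auto
  then have "\<rho> + e \<le> (r - 3) * \<mu> / (r - 1)"
    using thr by (simp add: e_def)
  then have main: "(r - 1) * (\<rho> + e) \<le> (r - 3) * \<mu>"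
    using r by (simp add: pos_le_divide_eq mult.commute)
  have pos: "0 < (r - 3) * \<mu>" using r \<open>0 < \<mu>\<close> by simp
  have "(r - 3) * \<rho> + (r + 11) * \<delta> + max 0 (2 * \<rho>) < (r - 3) * \<mu>"
  proof (cases "0 \<le> \<rho>")
    case True
    have "(r - 3) * \<rho> + (r + 11) * \<delta> + 2 * \<rho> = (r - 1) * (\<rho> + e) - 2 * e"
      unfolding e by (simp add: algebra_simps)
    moreover have "(r - 1) * (\<rho> + e) - 2 * e < (r - 3) * \<mu>"
    proof (cases "\<delta> = 0")
      case True
      then show ?thesis using pos assms(3) by (simp add: e_def)
    next
      case False
      then have "0 < e" using r \<open>0 \<le> \<delta>\<close> by (simp add: e_def)
      then show ?thesis using main by simp
    qed
    ultimately show ?thesis using True by simp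
  next
    case False
    have "(r - 3) * (\<rho> + e) < (r - 3) * \<mu>"
    proof (cases "\<rho> + e \<le> 0")
      case True
      then have "(r - 3) * (\<rho> + e) \<le> 0" using r by (simp add: mult_nonneg_nonpos)
      then show ?thesis using pos by simp
    next
      case False
      then have "(r - 3) * (\<rho> + e) < (r - 1) * (\<rho> + e)" by (intro mult_strict_right_mono) auto
      then show ?thesis using main by simp
    qed
    then show ?thesis using False unfolding e by (simp add: distrib_left)
  qed
  then have "((r - 3) * \<rho> + (r + 11) * \<delta> + max 0 (2 * \<rho>)) * s < (r - 3) * \<mu> * s"
    using s by (rule mult_strict_right_mono)
  moreover have "\<rho> / 2 * f \<le> max 0 (2 * \<rho>) * s"
  proof (cases "0 \<le> \<rho>")
    case True
    then have "\<rho> / 2 * f \<le> \<rho> / 2 * (4 * s)" using f by (intro mult_left_mono) auto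
    then show ?thesis using True by simp
  next
    case False
    then have "\<rho> / 2 * f \<le> 0" using f by (simp add: mult_nonpos_nonneg)
    then show ?thesis using False by simp
  qed
  ultimately show ?thesis by (simp add: algebra_simps)
qed

theorem theorem1:
  fixes A \<Delta> C :: "real^'n^'n" and z :: "real^'n" and Y :: "real^'r^'n"
  assumes "adjacency_matrix A"
    and "connected_graph A"
    and "\<And>i. z $ i \<in> {-1, 1}"
    and "transpose \<Delta> = \<Delta>"
    and "\<And>i. \<Delta> $ i $ i = 0"
    and "C = diag z ** A ** diag z + \<Delta>"
    and "(4 \<le> CARD('r) \<and>
          rho \<Delta> z + (real CARD('r) + 11) / (real CARD('r) - 3) * op_norm \<Delta>
            \<le> (real CARD('r) - 3) / (real CARD('r) - 1) * algebraic_connectivity A)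
         \<or> (CARD('r) = 3 \<and> \<Delta> = 0)"
    and "second_order_critical C Y"
  shows "\<exists>u::real^'r. norm u = 1 \<and> Y = (\<chi> i j. z $ i * u $ j)"
proof -
  note adj = assms(1) and conn = assms(2) and z = assms(3) and crit = assms(8)
  let ?r = "real CARD('r)"
  have zz: "z $ i * z $ i = 1" "z $ i * (z $ i * b) = b" "\<bar>z $ i\<bar> = 1" for i b
    using z[of i] by auto
  have A_nonneg: "0 \<le> A $ i $ j" for i j
    using adj by (simp add: adjacency_matrix_def)
  have \<Delta>_sym: "\<Delta> $ i $ j = \<Delta> $ j $ i" for i j
    using assms(4) by (metis transpose_def vec_lambda_beta)
  have C_nth: "C $ i $ j = z $ i * z $ j * A $ i $ j + \<Delta> $ i $ j" for i j
    by (simp add: assms(6) matrix_matrix_mult_def diag_def if_distrib if_distribR cong: if_cong)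
  have C_sym: "transpose C = C"
    by (simp add: vec_eq_iff transpose_def C_nth \<Delta>_sym adjacency_matrix_sym[OF adj, of _ i for i] mult.commute)
  define D :: "real^'n^'n" where "D = (\<chi> i j. z $ i * z $ j * \<Delta> $ i $ j)"
  define y where "y i = z $ i *\<^sub>R Y $ i" for i
  have y1: "norm (y i) = 1" for i
    using crit by (simp add: y_def zz second_order_critical_def feasible_iff)
  have Y_y: "Y $ i = z $ i *\<^sub>R y i" for i by (simp add: y_def zz)
  have conclude: ?thesis if "\<And>i j. y i = y j"
  proof -
    define u where "u = y undefined"
    have u: "y i = u" for i unfolding u_def by (rule that)
    have "norm u = 1" by (simp add: u_def y1)
    moreover have "Y = (\<chi> i j. z $ i * u $ j)" by (simp add: vec_eq_iff Y_y u)
    ultimately show ?thesis by blast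
  qed
  define q where "q i j = (norm (y i - y j))\<^sup>2 / 2" for i j
  have q: "1 - y i \<bullet> y j = q i j" for i j
    using y1 by (simp add: q_def half_norm_diff_squared)
  let ?S = "\<lambda>M f. \<Sum>i\<in>UNIV. \<Sum>j\<in>UNIV. M $ i $ j * (f i j :: real)"
  have second_order: "(\<Sum>i\<in>UNIV. \<Sum>j\<in>UNIV. (A $ i $ j + D $ i $ j) * (q i j * (?r - 3 + q i j))) \<le> 0"
  proof -
    have coeff: "z $ i * z $ j * C $ i $ j = A $ i $ j + D $ i $ j" for i j
      using z[of i] z[of j] by (auto simp: C_nth D_def)
    have factor: "(1 - y i \<bullet> y j) * (?r - 2 - y i \<bullet> y j) = q i j * (?r - 3 + q i j)" for i j
      by (simp add: q[symmetric])
    show ?thesis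
      using second_order_averaged[OF C_sym z crit]
      unfolding y_def[symmetric] by (simp only: coeff factor)
  qed
  show ?thesis
  proof (cases "\<Delta> = 0 \<and> CARD('r) = 3")
    case True
    then have "?S A (\<lambda>i j. (q i j)\<^sup>2) \<le> 0"
      using second_order by (simp add: D_def power2_eq_square)
    moreover have "0 \<le> A $ i $ j * (q i j)\<^sup>2" for i j
      by (simp add: A_nonneg)
    ultimately have "?S A (\<lambda>i j. (q i j)\<^sup>2) = 0"
      by (intro antisym sum_nonneg)
    then have zero: "A $ i $ j * (q i j)\<^sup>2 = 0" for i j
      using A_nonneg by (simp add: sum_nonneg_eq_0_iff sum_nonneg)
    have "y i = y j" for i j
      by (rule connected_graph_constant[OF conn, of y]) (use zero in \<open>fastforce simp: q_def\<close>)
    then show ?thesis by (rule conclude)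
  next
    case False
    then have r: "3 < ?r" and thr: "rho \<Delta> z + (?r + 11) / (?r - 3) * op_norm \<Delta>
        \<le> (?r - 3) / (?r - 1) * algebraic_connectivity A"
      using assms(7) by auto
    show ?thesis
    proof (cases "CARD('n) = 1")
      case True
      then obtain k where "UNIV = {k :: 'n}" by (auto simp: card_1_singleton_iff)
      then have "i = j" for i j :: 'n by (metis UNIV_I singletonD)
      then show ?thesis by (intro conclude) metis
    next
      case n: False
      obtain \<mu> where mu: "\<mu> > 0" "algebraic_connectivity A \<le> \<mu>" and
        gap: "\<And>x. (\<Sum>i\<in>UNIV. x $ i) = 0 \<Longrightarrow> \<mu> * (norm x)\<^sup>2 \<le> x \<bullet> (laplacian A *v x)"
        using spectral_gap[OF adj conn n] by metis
      define m where "m = (1 / real CARD('n)) *\<^sub>R (\<Sum>i\<in>UNIV. y i)"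
      define w where "w i = y i - m" for i
      have w0: "(\<Sum>i\<in>UNIV. w i) = 0"
        by (simp add: w_def m_def sum_subtractf sum_constant_scaleR del: sum_constant)
      have w_diff: "q i j = (norm (w i - w j))\<^sup>2 / 2" for i j
        by (simp add: q_def w_def)
      have "norm (\<Sum>i\<in>UNIV. y i) \<le> real CARD('n)"
        using sum_norm_le[of UNIV y "\<lambda>_. 1"] y1 by simp
      then have "norm m \<le> 1" by (simp add: m_def)
      then have w2: "norm (w i) \<le> 2" for i
        using norm_triangle_ineq4[of "y i" m] y1[of i] by (simp add: w_def)
      have D_sym: "D $ i $ j = D $ j $ i" for i j
        by (simp add: D_def \<Delta>_sym[of i j])
      have D_op: "\<bar>x \<bullet> (D *v x')\<bar> \<le> op_norm \<Delta> * norm x * norm x'" for x x'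
      proof -
        \<comment> \<open>Conjugation by a diagonal sign matrix is an isometry.\<close>
        define flip :: "real^'n \<Rightarrow> real^'n" where "flip x = (\<chi> i. z $ i * x $ i)" for x
        have "x \<bullet> (D *v x') = flip x \<bullet> (\<Delta> *v flip x')"
          by (simp add: flip_def D_def inner_vec_def matrix_vector_mult_def sum_distrib_left mult_ac)
        moreover have "norm (flip x) = norm x" for x
          by (simp add: flip_def norm_vec_def abs_mult zz)
        ultimately show ?thesis using op_norm_bilinear[of "flip x" \<Delta> "flip x'"] by simp
      qed
      have D_rho: "- (\<Sum>j\<in>UNIV. D $ i $ j) \<le> rho \<Delta> z" for i
      proof -
        have "(\<Sum>j\<in>UNIV. D $ i $ j) = z $ i * (\<Sum>j\<in>UNIV. \<Delta> $ i $ j * z $ j)"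
          by (simp add: D_def sum_distrib_left mult_ac)
        also have "(\<Sum>j\<in>UNIV. \<Delta> $ i $ j * z $ j) = (\<Sum>j\<in>UNIV - {i}. \<Delta> $ i $ j * z $ j)"
          using assms(5) by (intro sum.mono_neutral_right) auto
        finally have "- (\<Sum>j\<in>UNIV. D $ i $ j) = rho_at \<Delta> z i"
          by (simp add: rho_at_def)
        then show ?thesis by (simp add: rho_def)
      qed
      let ?s = "\<Sum>i\<in>UNIV. (norm (w i))\<^sup>2" and ?f = "\<Sum>i\<in>UNIV. (norm (w i)) ^ 4"
      have "?s = 0"
      proof (rule ccontr)
        assume "?s \<noteq> 0"
        then have s: "0 < ?s" by (simp add: less_le sum_nonneg)
        have "norm (w i) ^ 4 \<le> 4 * (norm (w i))\<^sup>2" for i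
        proof -
          have "(norm (w i))\<^sup>2 * (norm (w i))\<^sup>2 \<le> 2\<^sup>2 * (norm (w i))\<^sup>2"
            using w2 by (intro mult_right_mono power_mono) auto
          then show ?thesis by (simp add: power_add[symmetric])
        qed
        then have f: "?f \<le> 4 * ?s"
          unfolding sum_distrib_left by (intro sum_mono)
        have rho0: "op_norm \<Delta> = 0 \<Longrightarrow> rho \<Delta> z = 0"
        proof -
          assume "op_norm \<Delta> = 0"
          then have "(\<Delta> *v x) \<bullet> (\<Delta> *v x) \<le> 0" for x
            using op_norm_bilinear[of "\<Delta> *v x" \<Delta> x] by simp
          then have "\<Delta> *v x = 0" for x by (metis inner_gt_zero_iff not_le)
          then have "\<Delta> = 0" by (metis matrix_eq matrix_vector_mult_0)
          then have "rho_at \<Delta> z = (\<lambda>_. 0)" by (simp add: fun_eq_iff rho_at_def)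
          then show "rho \<Delta> z = 0" by (simp add: rho_def)
        qed
        have "(?r - 3) * ?S A q + ?S A (\<lambda>i j. (q i j)\<^sup>2) + (?r - 3) * ?S D q + ?S D (\<lambda>i j. (q i j)\<^sup>2) =
          (\<Sum>i\<in>UNIV. \<Sum>j\<in>UNIV. (A $ i $ j + D $ i $ j) * (q i j * (?r - 3 + q i j)))"
          unfolding sum_distrib_left sum.distrib[symmetric]
          by (intro sum.cong refl) (simp add: algebra_simps power2_eq_square)
        moreover have "0 \<le> ?S A (\<lambda>i j. (q i j)\<^sup>2)"
          by (simp add: sum_nonneg A_nonneg)
        ultimately have "(?r - 3) * ?S A q \<le> (?r - 3) * (- ?S D q) + (- ?S D (\<lambda>i j. (q i j)\<^sup>2))"
          using second_order by simp
        moreover have "(?r - 3) * (\<mu> * ?s) \<le> (?r - 3) * ?S A q"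
          unfolding w_diff using r by (intro mult_left_mono spectral_gap_rows[OF adj gap w0]) auto
        moreover have "(?r - 3) * (- ?S D q) \<le> (?r - 3) * ((rho \<Delta> z + op_norm \<Delta>) * ?s)"
          unfolding w_diff using r
          by (intro mult_left_mono noise_quadratic[OF D_sym D_op op_norm_nonneg D_rho]) auto
        moreover have "- ?S D (\<lambda>i j. (q i j)\<^sup>2) \<le> rho \<Delta> z / 2 * ?f + 14 * op_norm \<Delta> * ?s"
          unfolding w_diff by (rule noise_quartic[OF D_sym D_op op_norm_nonneg D_rho w2])
        moreover have "(?r - 3) * ((rho \<Delta> z + op_norm \<Delta>) * ?s) +
            (rho \<Delta> z / 2 * ?f + 14 * op_norm \<Delta> * ?s) < (?r - 3) * (\<mu> * ?s)"
          by (rule threshold_arithmetic[OF r op_norm_nonneg rho0 mu s _ f thr]) (simp_all add: sum_nonneg)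
        ultimately show False by linarith
      qed
      then have "w i = 0" for i by (simp add: sum_nonneg_eq_0_iff)
      then have "y i = y j" for i j by (simp add: w_def)
      then show ?thesis by (rule conclude)
    qed
  qed
qed

end
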